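(* Let $F$ be a countable field and $E$ a countably infinite-dimensional $F$-vector space with fixed basis $(e_n)_{n\in\omega}$. Let $\mathcal{A}$ be a maximal almost disjoint family of block subspaces of $E$ with $|\mathcal{A}|\geq 2$. Then $\mathcal{A}$ is uncountable.
   Context: $F$ is a countable (possibly finite) field, $E$ is a vector space over $F$ of countably infinite dimension, and $(e_n)_{n\in\omega}$ is a fixed $F$-basis of $E$. For $x\in E$, $\mathrm{supp}(x)$ is the (finite) set of $n\in\omega$ such that $e_n$ has nonzero coefficient in the expansion of $x$. For nonzero $x,y\in E$, write $x<y$ if $\max(\mathrm{supp}(x))<\min(\mathrm{supp}(y))$. A block sequence is a sequence $(x_n)$ of nonzero vectors with $x_n<x_{n+1}$ for all $n$; a block subspace is the linear span of an infinite block sequence. Two infinite-dimensional subspaces $X,Y$ of $E$ are almost disjoint if $X\cap Y$ is finite-dimensional. An almost disjoint family of block subspaces is a set of pairwise almost disjoint block subspaces; it is maximal (a mad family of block subspaces) if it is not properly contained in another such family. *)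

theory Defs
  imports "HOL.Vector_Spaces" "HOL-Library.Countable_Set"
begin

locale based_vector_space = vector_space scale
  for scale :: "'f::field \<Rightarrow> 'e::ab_group_add \<Rightarrow> 'e" +
  fixes e :: "nat \<Rightarrow> 'e"
  assumes inj_basis: "inj e"
    and independent_basis: "independent (range e)"
    and span_basis: "span (range e) = UNIV"
begin

definition supp :: "'e \<Rightarrow> nat set" where
  "supp x = {n. representation (range e) x (e n) \<noteq> 0}"

text \<open>Only used for nonzero vectors, whose supports are finite and nonempty
  by \<open>finite_supp\<close> and \<open>supp_eq_empty_iff\<close> below.\<close>

definition block_less :: "'e \<Rightarrow> 'e \<Rightarrow> bool" where
  "block_less x y \<longleftrightarrow> Max (supp x) < Min (supp y)"

definition block_sequence :: "(nat \<Rightarrow> 'e) \<Rightarrow> bool" where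
  "block_sequence x \<longleftrightarrow> (\<forall>n. x n \<noteq> 0) \<and> (\<forall>n. block_less (x n) (x (Suc n)))"

definition block_subspace :: "'e set \<Rightarrow> bool" where
  "block_subspace X \<longleftrightarrow> (\<exists>x. block_sequence x \<and> X = span (range x))"

text \<open>The library's \<open>dim\<close> does not separate infinite-dimensional subspaces from the zero
  subspace, and its locale for finite dimension concerns the whole type.\<close>

definition finite_dim :: "'e set \<Rightarrow> bool" where
  "finite_dim V \<longleftrightarrow> (\<exists>B. finite B \<and> independent B \<and> span B = V)"

text \<open>Only applied to block subspaces, which are infinite-dimensional subspaces.\<close>

definition almost_disjoint :: "'e set \<Rightarrow> 'e set \<Rightarrow> bool" where
  "almost_disjoint X Y \<longleftrightarrow> finite_dim (X \<inter> Y)"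

definition ad_family :: "'e set set \<Rightarrow> bool" where
  "ad_family \<A> \<longleftrightarrow> (\<forall>X\<in>\<A>. block_subspace X) \<and> pairwise almost_disjoint \<A>"

definition mad_family :: "'e set set \<Rightarrow> bool" where
  "mad_family \<A> \<longleftrightarrow> ad_family \<A> \<and> \<not> (\<exists>\<B>. ad_family \<B> \<and> \<A> \<subset> \<B>)"

lemma finite_supp: "finite (supp x)"
proof -
  have "finite (e -` {b. representation (range e) x b \<noteq> 0})"
    by (intro finite_vimageI finite_representation inj_basis)
  then show ?thesis by (simp add: supp_def vimage_def)
qed

lemma supp_eq_empty_iff: "supp x = {} \<longleftrightarrow> x = 0"
proof
  assume "supp x = {}"
  then have "{b. representation (range e) x b \<noteq> 0} = {}"
    unfolding supp_def using representation_ne_zero by fastforce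
  then show "x = 0"
    using sum_nonzero_representation_eq[OF independent_basis, of x] span_basis by simp
qed (simp add: supp_def representation_zero)

end

end

theory Submission
  imports Defs
begin

text \<open>A block subspace of finite codimension meets every other block subspace in infinite
  dimension, so the members \<open>X\<^sub>n\<close> of an almost disjoint family with at least two elements all have
  infinite codimension. By B. H. Neumann's covering lemma, finitely many subspaces of infinite
  codimension never cover a tail subspace of \<open>E\<close>, even over a finite field. If the family is
  countable, one can thus choose a block sequence \<open>y\<close> with \<open>y\<^sub>m \<notin> X\<^sub>n + \<langle>y\<^sub>i | i < m\<rangle>\<close>
  for all \<open>n \<le> m\<close>. Then \<open>X\<^sub>n \<inter> \<langle>y\<^sub>i | i\<rangle>\<close> lies in \<open>\<langle>y\<^sub>i | i < n\<rangle>\<close>, and the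
  family is not maximal.\<close>

section \<open>Coverings by finitely many cosets\<close>

text \<open>B. H. Neumann's lemma, by induction on the number of subgroups. Infinite index leaves a
  coset \<open>c + W\<close> distinct from all listed cosets of \<open>W\<close>; a suitable point
  is found either directly or by translating into \<open>c + W\<close>.\<close>

lemma avoid_finitely_many_cosets:
  fixes V :: "'a::ab_group_add set"
  assumes V: "0 \<in> V" "\<And>x y. x \<in> V \<Longrightarrow> y \<in> V \<Longrightarrow> x - y \<in> V"
    and "finite \<W>"
    and "\<And>W x y. W \<in> \<W> \<Longrightarrow> x \<in> W \<Longrightarrow> y \<in> W \<Longrightarrow> x - y \<in> W"
    and "\<And>W A. W \<in> \<W> \<Longrightarrow> finite A \<Longrightarrow> A \<subseteq> V \<Longrightarrow> \<exists>v\<in>V. \<forall>a\<in>A. v - a \<notin> W"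
    and "finite P" "P \<subseteq> V \<times> \<W>"
  shows "\<exists>v\<in>V. \<forall>(a, W)\<in>P. v - a \<notin> W"
  using assms(3-)
proof (induction \<W> arbitrary: P rule: finite_induct)
  case empty
  then show ?case using V(1) by auto
next
  case (insert W \<W>)
  define A where "A = {a. (a, W) \<in> P}"
  define Q where "Q = {p \<in> P. snd p \<in> \<W>}"
  have "A \<subseteq> fst ` P" unfolding A_def by force
  then have A: "finite A" "A \<subseteq> V"
    using insert.prems(3,4) finite_subset unfolding A_def by blast+
  obtain c where c: "c \<in> V" "\<And>a. a \<in> A \<Longrightarrow> c - a \<notin> W"
    using insert.prems(2)[of W A] A by blast
  \<comment> \<open>The remaining cosets are also avoided after translation by each
    \<open>a - c\<close>, so that a point of \<open>a + W\<close> can later be moved by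
    \<open>c - a\<close> into \<open>c + W\<close> without entering them.\<close>
  define shift where "shift = (\<lambda>(a, b, U :: 'a set). (b + (a - c), U))"
  have Q: "finite Q" "Q \<subseteq> V \<times> \<W>"
    using insert.prems(3,4) unfolding Q_def by auto
  have V_add: "x + y \<in> V" if "x \<in> V" "y \<in> V" for x y
    using V(2)[OF that(1) V(2)[OF V(1) that(2)]] by simp
  have "shift ` (A \<times> Q) \<subseteq> V \<times> \<W>"
    using A(2) Q(2) c(1) by (auto simp: shift_def intro!: V_add V(2))
  then have sub: "Q \<union> shift ` (A \<times> Q) \<subseteq> V \<times> \<W>"
    using Q by blast
  have "\<exists>v\<in>V. \<forall>(a, W)\<in>Q \<union> shift ` (A \<times> Q). v - a \<notin> W"
    by (rule insert.IH[OF _ _ _ sub])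
      (use insert.prems(1,2) A(1) Q(1) in blast)+
  then obtain v where v: "v \<in> V" "\<forall>(a, W)\<in>Q \<union> shift ` (A \<times> Q). v - a \<notin> W"
    by blast
  have split: "p \<in> Q \<or> (fst p \<in> A \<and> snd p = W)" if "p \<in> P" for p
    using that insert.prems(4) unfolding Q_def A_def by auto
  show ?case
  proof (cases "\<exists>a\<in>A. v - a \<in> W")
    case False
    have "v - a \<notin> U" if "(a, U) \<in> P" for a U
      using split[OF that] v(2) False by auto
    then show ?thesis using v(1) by blast
  next
    case True
    then obtain a where a: "a \<in> A" "v - a \<in> W" by blast
    have "v + (c - a) - b \<notin> U" if p: "(b, U) \<in> P" for b U
    proof (cases "(b, U) \<in> Q")
      case True
      then have "shift (a, b, U) \<in> Q \<union> shift ` (A \<times> Q)"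
        using a(1) by blast
      from bspec[OF v(2) this] have "v - (b + (a - c)) \<notin> U"
        by (simp add: shift_def)
      then show ?thesis by (simp add: algebra_simps)
    next
      case False
      then have b: "b \<in> A" "U = W" using split[OF p] by auto
      show ?thesis
      proof
        assume "v + (c - a) - b \<in> U"
        \<comment> \<open>This difference is \<open>c - b\<close>, while \<open>c\<close> was chosen
          outside \<open>b + W\<close>.\<close>
        then have "(v + (c - a) - b) - (v - a) \<in> W"
          using insert.prems(1)[of W] a(2) b(2) by blast
        then show False using c(2)[OF b(1)] by (simp add: algebra_simps)
      qed
    qed
    moreover have "v + (c - a) \<in> V"
      using v(1) c(1) a(1) A(2) by (auto intro!: V_add V(2))
    ultimately show ?thesis by blast
  qed
qed

section \<open>Linear algebra of intersections with spans\<close>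

context vector_space
begin

text \<open>Each vector added to \<open>X\<close> enlarges the intersection by at most one
  dimension: a single new element \<open>d\<close> of \<open>Y\<close> can cancel the
  \<open>b\<close>-component of every other one.\<close>

lemma finite_spanned_Int_span_Un:
  assumes Y: "subspace Y" and X: "subspace X"
    and C: "finite C" "Y \<inter> X \<subseteq> span C" and B: "finite B"
  shows "\<exists>C. finite C \<and> Y \<inter> span (X \<union> B) \<subseteq> span C"
  using B
proof (induction B rule: finite_induct)
  case empty
  then show ?case using C X by (auto simp: span_eq_iff[THEN iffD2])
next
  case (insert b B)
  then obtain C where C: "finite C" "Y \<inter> span (X \<union> B) \<subseteq> span C" by blast
  show ?case
  proof (cases "Y \<inter> span (X \<union> insert b B) \<subseteq> span (X \<union> B)")
    case True
    then show ?thesis using C by blast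
  next
    case False
    then obtain d where d: "d \<in> Y" "d \<in> span (insert b (X \<union> B))" "d \<notin> span (X \<union> B)"
      by auto
    from d(2) obtain k where k: "d - scale k b \<in> span (X \<union> B)"
      unfolding span_insert by blast
    have "k \<noteq> 0" using k d(3) by auto
    have "z \<in> span (insert d C)" if z: "z \<in> Y" "z \<in> span (insert b (X \<union> B))" for z
    proof -
      from z(2) obtain l where l: "z - scale l b \<in> span (X \<union> B)"
        unfolding span_insert by blast
      have "z - scale (l / k) d = (z - scale l b) - scale (l / k) (d - scale k b)"
        using \<open>k \<noteq> 0\<close> by (simp add: scale_right_diff_distrib)
      also have "\<dots> \<in> span (X \<union> B)"
        by (rule span_diff[OF l span_scale[OF k]])
      finally have "z - scale (l / k) d \<in> Y \<inter> span (X \<union> B)"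
        using z(1) d(1) Y by (auto intro: subspace_diff subspace_scale)
      then show ?thesis using C(2) unfolding span_insert by blast
    qed
    then show ?thesis using C(1) by (intro exI[of _ "insert d C"]) auto
  qed
qed

text \<open>An element of the intersection uses finitely many \<open>y i\<close>. While the last
  index is at least \<open>n\<close>, its coefficient must vanish, since otherwise that vector would
  lie in the span of \<open>X\<close> and its predecessors.\<close>

lemma Int_span_range_subset:
  fixes y :: "nat \<Rightarrow> 'b"
  assumes X: "subspace X" and y: "\<And>m. n \<le> m \<Longrightarrow> y m \<notin> span (X \<union> y ` {..<m})"
  shows "X \<inter> span (range y) \<subseteq> span (y ` {..<n})"
proof
  fix v assume v: "v \<in> X \<inter> span (range y)"
  then obtain T where T: "finite T" "T \<subseteq> range y" "v \<in> span T"
    unfolding span_explicit[of "range y"] by (blast intro: span_sum span_scale span_base)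
  then obtain I where I: "finite I" "T = y ` I"
    using finite_subset_image by metis
  then obtain m where "I \<subseteq> {..<m}"
    using finite_nat_iff_bounded by blast
  then have "v \<in> span (y ` {..<m})"
    using T I by (meson image_mono span_mono subsetD)
  then show "v \<in> span (y ` {..<n})"
  proof (induction m)
    case 0
    then show ?case using span_mono[of "{}" "y ` {..<n}"] by auto
  next
    case (Suc m)
    show ?case
    proof (cases "n \<le> m")
      case True
      have "v \<in> span (insert (y m) (y ` {..<m}))"
        using Suc.prems by (simp add: lessThan_Suc)
      then obtain k where k: "v - scale k (y m) \<in> span (y ` {..<m})"
        unfolding span_insert by blast
      have "k = 0"
      proof (rule ccontr)
        assume "k \<noteq> 0"
        then have "y m = scale (1 / k) (v - (v - scale k (y m)))" by simp
        also have "\<dots> \<in> span (X \<union> y ` {..<m})"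
        proof (rule span_scale[OF span_diff])
          show "v \<in> span (X \<union> y ` {..<m})" using v by (auto intro: span_base)
          show "v - scale k (y m) \<in> span (X \<union> y ` {..<m})"
            using k span_mono[of "y ` {..<m}" "X \<union> y ` {..<m}"] by blast
        qed
        finally show False using y[OF True] by blast
      qed
      then show ?thesis using k Suc.IH by simp
    next
      case False
      then have "y ` {..<Suc m} \<subseteq> y ` {..<n}" by auto
      then show ?thesis using Suc.prems span_mono by blast
    qed
  qed
qed

end

section \<open>Supports and block subspaces\<close>

context based_vector_space
begin

lemma supp_add: "supp (x + y) \<subseteq> supp x \<union> supp y"
  unfolding supp_def using representation_add[OF independent_basis] span_basis by auto

lemma supp_scale: "supp (scale c x) \<subseteq> supp x"
  unfolding supp_def using representation_scale[OF independent_basis] span_basis by auto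

lemma supp_basis: "supp (e n) = {n}"
  unfolding supp_def using inj_basis
  by (auto simp: representation_basis[OF independent_basis] inj_eq)

text \<open>Needed for finite \<open>K\<close>, to bound supports in a finite span, and for
  \<open>K = {N..}\<close>, the tail subspace.\<close>

lemma subspace_supp_subset: "subspace {v. supp v \<subseteq> K}"
  using supp_add supp_scale
  by (intro subspaceI) (auto simp: supp_eq_empty_iff[THEN iffD2], blast+)

lemma finite_dim_subset_span:
  assumes "subspace X" "finite C" "X \<subseteq> span C"
  shows "finite_dim X"
proof -
  obtain B where B: "B \<subseteq> X" "independent B" "X \<subseteq> span B"
    using maximal_independent_subset by blast
  have "finite B" using independent_span_bound[OF assms(2) B(2)] B(1) assms(3) by auto
  then show ?thesis
    unfolding finite_dim_def using B assms(1) span_minimal by blast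
qed

lemma subspace_block_subspace: "block_subspace X \<Longrightarrow> subspace X"
  by (auto simp: block_subspace_def)

lemma block_sequence_le_Max_supp: "block_sequence x \<Longrightarrow> n \<le> Max (supp (x n))"
proof (induction n)
  case (Suc n)
  then have "n \<le> Max (supp (x n))" by blast
  also have "\<dots> < Min (supp (x (Suc n)))"
    using Suc.prems by (simp add: block_sequence_def block_less_def)
  also have "\<dots> \<le> Max (supp (x (Suc n)))"
    using Suc.prems by (simp add: block_sequence_def finite_supp supp_eq_empty_iff)
  finally show ?case by simp
qed simp

text \<open>Vectors in a finite span have supports in one finite set, whereas the maxima of the
  supports in a block sequence are unbounded.\<close>

lemma block_subspace_not_subset_span:
  assumes "block_subspace X" "finite C"
  shows "\<not> X \<subseteq> span C"
proof
  assume sub: "X \<subseteq> span C"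
  obtain x where x: "block_sequence x" "X = span (range x)"
    using assms(1) by (auto simp: block_subspace_def)
  define K where "K = (\<Union>c\<in>C. supp c)"
  have "finite K" using assms(2) finite_supp by (auto simp: K_def)
  have "span C \<subseteq> {v. supp v \<subseteq> K}"
    by (rule span_minimal[OF _ subspace_supp_subset]) (auto simp: K_def)
  then have K: "supp (x n) \<subseteq> K" for n
    using sub x(2) span_base[of "x n" "range x"] by blast
  have "Max (supp (x n)) \<in> supp (x n)" for n
    using x(1) by (intro Max_in) (auto simp: finite_supp supp_eq_empty_iff block_sequence_def)
  then have "n \<le> Max K" for n
    using K block_sequence_le_Max_supp[OF x(1), of n] \<open>finite K\<close>
    by (meson Max_ge in_mono le_trans)
  then show False using not_less_eq_eq by blast
qed

section \<open>Diagonalization against a countable family\<close>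

text \<open>If \<open>X\<close> had a finite complement \<open>B\<close>, then \<open>Y\<close>
  would be its own intersection with \<open>span (X \<union> B)\<close>, hence finitely spanned
  because \<open>Y \<inter> X\<close> is.\<close>

lemma almost_disjoint_infinite_codim:
  assumes "block_subspace X" "block_subspace Y" "almost_disjoint X Y" "finite B"
  shows "span (X \<union> B) \<noteq> UNIV"
proof
  assume "span (X \<union> B) = UNIV"
  moreover obtain C where "finite C" "Y \<inter> X \<subseteq> span C"
    using assms(3) by (auto simp: almost_disjoint_def finite_dim_def Int_commute)
  ultimately obtain D where "finite D" "Y \<subseteq> span D"
    using finite_spanned_Int_span_Un[of Y X C B] assms subspace_block_subspace by auto
  then show False using block_subspace_not_subset_span assms(2) by blast
qed

lemma tail_vector_outside:
  fixes X :: "nat \<Rightarrow> 'e set" and N n :: nat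
  assumes codim: "\<And>k B. finite B \<Longrightarrow> span (X k \<union> B) \<noteq> UNIV" and S: "finite S"
  shows "\<exists>v. supp v \<subseteq> {N..} \<and> (\<forall>k\<le>n. v \<notin> span (X k \<union> S))"
proof -
  define V where "V = {v. supp v \<subseteq> {N..}}"
  define \<W> where "\<W> = (\<lambda>k. span (X k \<union> S)) ` {..n}"
  have sV: "subspace V" unfolding V_def by (rule subspace_supp_subset)
  \<comment> \<open>If translates of \<open>W\<close> by a finite \<open>A\<close> covered the tail
    \<open>V\<close>, then adding \<open>A\<close> and the finitely many \<open>e i\<close> below
    \<open>N\<close> to \<open>W\<close> would span the whole space, against
    \<open>codim\<close>.\<close>
  have index: "\<exists>v\<in>V. \<forall>a\<in>A. v - a \<notin> W" if W: "W \<in> \<W>" and A: "finite A" for W A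
  proof (rule ccontr)
    assume contra: "\<not> ?thesis"
    from W obtain k where k: "W = span (X k \<union> S)" by (auto simp: \<W>_def)
    define B where "B = S \<union> A \<union> e ` {..<N}"
    have "finite B" using S A by (simp add: B_def)
    have "e i \<in> span (X k \<union> B)" for i
    proof (cases "i < N")
      case True
      then show ?thesis by (auto intro: span_base simp: B_def)
    next
      case False
      then have "e i \<in> V" by (simp add: V_def supp_basis)
      then obtain a where a: "a \<in> A" "e i - a \<in> W" using contra by blast
      have "e i - a \<in> span (X k \<union> B)"
        using a(2) span_mono[of "X k \<union> S" "X k \<union> B"] by (auto simp: k B_def)
      moreover have "a \<in> span (X k \<union> B)" using a(1) by (auto intro: span_base simp: B_def)
      ultimately show ?thesis using span_add by fastforce
    qed
    then have "span (range e) \<subseteq> span (X k \<union> B)"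
      by (intro span_minimal) auto
    then show False using codim[OF \<open>finite B\<close>] span_basis by auto
  qed
  \<comment> \<open>Only the subspaces themselves have to be avoided, as cosets of 0; general cosets
    serve the induction in the covering lemma.\<close>
  have "\<exists>v\<in>V. \<forall>(a, W)\<in>{0} \<times> \<W>. v - a \<notin> W"
  proof (rule avoid_finitely_many_cosets[where \<W> = \<W>])
    show "x - y \<in> W" if "W \<in> \<W>" "x \<in> W" "y \<in> W" for W x y
      using that by (auto simp: \<W>_def intro: span_diff)
  qed (use sV index subspace_0 subspace_diff in \<open>auto simp: \<W>_def\<close>)
  then show ?thesis by (auto simp: V_def \<W>_def)
qed

lemma block_subspace_almost_disjoint_from_sequence:
  fixes X :: "nat \<Rightarrow> 'e set"
  assumes sub: "\<And>k. subspace (X k)" and codim: "\<And>k B. finite B \<Longrightarrow> span (X k \<union> B) \<noteq> UNIV"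
  shows "\<exists>Y. block_subspace Y \<and> (\<forall>k. almost_disjoint (X k) Y)"
proof -
  \<comment> \<open>Stage \<open>n\<close> treats only \<open>X k\<close> with
    \<open>k \<le> n\<close>, so finitely many subspaces are avoided at a time; the price for
    \<open>X k\<close> is a possible intersection inside the span of the first \<open>k\<close>
    vectors.\<close>
  define P where "P = (\<lambda>y n v. (\<forall>i<n. \<forall>a\<in>supp (y i). \<forall>b\<in>supp v. a < b)
    \<and> (\<forall>k\<le>n. v \<notin> span (X k \<union> y ` {..<n})))"
  have "\<exists>y. \<forall>n. P y n (y n)"
  proof (rule dependent_wf_choice[OF wf_less])
    show "P f n r = P g n r" if "\<And>z. (z, n) \<in> {(x, y). x < y} \<Longrightarrow> f z = g z"
      for f g :: "nat \<Rightarrow> 'e" and n :: nat and r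
    proof -
      have "f i = g i" if "i < n" for i using \<open>\<And>z. _ \<Longrightarrow> f z = g z\<close> that by simp
      moreover from this have "f ` {..<n} = g ` {..<n}" by (intro image_cong) auto
      ultimately show ?thesis by (simp add: P_def)
    qed
  next
    fix n :: nat and y :: "nat \<Rightarrow> 'e"
    have "finite (\<Union>i<n. supp (y i))" by (simp add: finite_supp)
    then obtain N where N: "(\<Union>i<n. supp (y i)) \<subseteq> {..<N}"
      using finite_nat_iff_bounded by blast
    obtain v where v: "supp v \<subseteq> {N..}" "\<forall>k\<le>n. v \<notin> span (X k \<union> y ` {..<n})"
      using tail_vector_outside[where X = X and S = "y ` {..<n}", OF codim] by blast
    have "a < b" if "i < n" "a \<in> supp (y i)" "b \<in> supp v" for i a b
    proof -
      have "a < N" using N that by blast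
      moreover have "N \<le> b" using v(1) that(3) by auto
      ultimately show ?thesis by simp
    qed
    then show "\<exists>v. P y n v" using v(2) by (auto simp: P_def)
  qed
  then obtain y where y: "\<And>n. P y n (y n)" by blast
  have nz: "y n \<noteq> 0" for n
    using y[of n] span_zero by (auto simp: P_def)
  have "block_less (y n) (y (Suc n))" for n
  proof -
    have "Max (supp (y n)) \<in> supp (y n)" "Min (supp (y (Suc n))) \<in> supp (y (Suc n))"
      using nz by (auto intro!: Max_in Min_in simp: finite_supp supp_eq_empty_iff)
    then show ?thesis using y[of "Suc n"] by (auto simp: P_def block_less_def)
  qed
  then have block: "block_subspace (span (range y))"
    using nz by (auto simp: block_subspace_def block_sequence_def)
  have "almost_disjoint (X k) (span (range y))" for k
    unfolding almost_disjoint_def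
  proof (rule finite_dim_subset_span)
    show "X k \<inter> span (range y) \<subseteq> span (y ` {..<k})"
      using y by (intro Int_span_range_subset sub) (auto simp: P_def)
  qed (auto intro: subspace_inter sub)
  then show ?thesis using block by blast
qed

lemma uncountable_mad_family:
  assumes mad: "mad_family \<A>" and two: "X\<^sub>0 \<in> \<A>" "X\<^sub>1 \<in> \<A>" "X\<^sub>0 \<noteq> X\<^sub>1"
  shows "uncountable \<A>"
proof
  assume "countable \<A>"
  \<comment> \<open>The enumeration may repeat members, so finite families are included.\<close>
  then obtain X where X: "\<A> = range (X :: nat \<Rightarrow> 'e set)"
    using two(1) uncountable_def by (metis empty_iff)
  have block: "block_subspace (X k)" for k
    using mad X by (auto simp: mad_family_def ad_family_def)
  have ad: "pairwise almost_disjoint \<A>"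
    using mad by (simp add: mad_family_def ad_family_def)
  have codim: "span (X k \<union> B) \<noteq> UNIV" if "finite B" for k B
  proof -
    obtain Z where "Z \<in> \<A>" "Z \<noteq> X k" using two by metis
    then show ?thesis
      using ad mad X that almost_disjoint_infinite_codim[OF block, of Z k B]
      by (auto simp: pairwise_def mad_family_def ad_family_def)
  qed
  obtain Y where Y: "block_subspace Y" "\<And>k. almost_disjoint (X k) Y"
    using block_subspace_almost_disjoint_from_sequence[of X] subspace_block_subspace block codim
    by metis
  \<comment> \<open>If \<open>Y\<close> were some \<open>X k\<close>, then
    \<open>Y \<inter> Y = Y\<close> would be finite-dimensional; so \<open>Y\<close> properly
    extends the family.\<close>
  have "\<not> finite_dim Y"
    using block_subspace_not_subset_span[OF Y(1)] unfolding finite_dim_def by blast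
  then have "Y \<notin> \<A>" using Y(2) X by (metis Int_absorb almost_disjoint_def rangeE)
  moreover have "ad_family (insert Y \<A>)"
    unfolding ad_family_def
    using ad block Y X by (auto simp: pairwise_insert almost_disjoint_def Int_commute)
  ultimately show False using mad unfolding mad_family_def by blast
qed

end

theorem proposition2p5:
  fixes scale :: "'f::field \<Rightarrow> 'e::ab_group_add \<Rightarrow> 'e"
    and e :: "nat \<Rightarrow> 'e"
    and \<A> :: "'e set set"
  assumes "countable (UNIV :: 'f set)"
    and "based_vector_space scale e"
    and "based_vector_space.mad_family scale e \<A>"
    and "infinite \<A> \<or> card \<A> \<ge> 2"
  shows "uncountable \<A>"
proof -
  interpret based_vector_space scale e by fact
  \<comment> \<open>\<open>card\<close> is 0 on infinite sets, which is why the infinite case is a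
    separate disjunct.\<close>
  have "\<not> is_singleton \<A>" "\<A> \<noteq> {}"
    using assms(4) by (auto simp: is_singleton_def)
  then obtain X\<^sub>0 X\<^sub>1 where "X\<^sub>0 \<in> \<A>" "X\<^sub>1 \<in> \<A>" "X\<^sub>0 \<noteq> X\<^sub>1"
    by (metis is_singletonI' equals0I)
  then show ?thesis using uncountable_mad_family assms(3) by blast
qed

end
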